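(* Let $K$ be a field, let $S=K[x_1,\dots,x_n]$, and let $I\subset S$ be a squarefree monomial ideal generated by $4$ elements, i.e. $I=(v_1,v_2,v_3,v_4)$ for squarefree monomials $v_1,\dots,v_4\in S$. Then $\operatorname{sdepth}(I)\ge n-2$.
   Context: $S=K[x_1,\dots,x_n]$ is the polynomial ring in $n$ variables over the field $K$, with its standard $\mathbb{Z}^n$-grading. A monomial is squarefree if no variable occurs in it with exponent larger than $1$. The four generators are not required to be a minimal generating set. Stanley depth: for a monomial $u\in I$ and a subset $Z\subseteq\{x_1,\dots,x_n\}$, the $K$-subspace $uK[Z]$ of $I$ (spanned by all $uw$ with $w$ a monomial in the variables of $Z$) is called a Stanley space. A Stanley decomposition of $I$ is a finite direct sum decomposition $\mathcal{D}: I=\bigoplus_{i=1}^r u_iK[Z_i]$ of $I$ as a $\mathbb{Z}^n$-graded $K$-vector space into Stanley spaces (i.e. every monomial of $I$ lies in exactly one $u_iK[Z_i]$). Its Stanley depth is $\operatorname{sdepth}(\mathcal{D})=\min\{|Z_i| : 1\le i\le r\}$, and $\operatorname{sdepth}(I)$ is the maximum of $\operatorname{sdepth}(\mathcal{D})$ over all Stanley decompositions $\mathcal{D}$ of $I$. *)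

theory Defs
  imports Complex_Main "HOL-Library.Poly_Mapping" "HOL-Library.FuncSet" "HOL-Library.Cardinality"
begin

text \<open>
  The polynomial ring \<open>S = K[x\<^sub>1, \<dots>, x\<^sub>n]\<close> is the monoid algebra over the field \<open>'k\<close> of the exponent
  vectors \<open>'n \<Rightarrow>\<^sub>0 nat\<close>; the variables are indexed by the finite type \<open>'n\<close>, so \<open>n = CARD('n)\<close>.
\<close>

type_synonym 'n expo = "'n \<Rightarrow>\<^sub>0 nat"
type_synonym ('n, 'k) mpoly = "'n expo \<Rightarrow>\<^sub>0 'k"

definition monom :: "'n expo \<Rightarrow> ('n, 'k::field) mpoly" where
  "monom a = Poly_Mapping.single a 1"

definition squarefree_monomial :: "('n, 'k::field) mpoly \<Rightarrow> bool" where
  "squarefree_monomial v \<longleftrightarrow> (\<exists>a. v = monom a \<and> (\<forall>i. Poly_Mapping.lookup a i \<le> 1))"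

definition scale :: "'k::field \<Rightarrow> ('n, 'k) mpoly \<Rightarrow> ('n, 'k) mpoly" where
  "scale c p = Poly_Mapping.single 0 c * p"

lemma module_mult: "module ((*) :: ('n, 'k::field) mpoly \<Rightarrow> _)"
  by unfold_locales (simp_all add: algebra_simps)

lemma vector_space_scale: "vector_space (scale :: 'k::field \<Rightarrow> ('n, 'k) mpoly \<Rightarrow> _)"
  by unfold_locales
    (simp_all add: scale_def algebra_simps single_add mult_single flip: mult.assoc)

definition ideal_generated :: "('n, 'k::field) mpoly set \<Rightarrow> ('n, 'k) mpoly set" where
  "ideal_generated B = module.span (*) B"

text \<open>\<open>stanley_space u Z\<close> is \<open>uK[Z]\<close>, with \<open>u\<close> given by its exponent vector.\<close>

definition stanley_space :: "'n expo \<Rightarrow> 'n set \<Rightarrow> ('n, 'k::field) mpoly set" where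
  "stanley_space u Z =
     module.span scale {monom u * monom w | w. Poly_Mapping.keys w \<subseteq> Z}"

text \<open>
  A decomposition is recorded as the finite set of its pairs \<open>(u\<^sub>i, Z\<^sub>i)\<close>: the sum is direct and
  Stanley spaces are nonzero, so no pair can occur twice. The last conjunct says that \<open>I\<close> is the
  internal direct sum of the Stanley spaces. This is a decomposition as a \<open>\<int>\<^sup>n\<close>-graded space
  because each Stanley space is spanned by monomials.
\<close>

definition stanley_decomposition ::
    "('n, 'k::field) mpoly set \<Rightarrow> ('n expo \<times> 'n set) set \<Rightarrow> bool" where
  "stanley_decomposition I D \<longleftrightarrow>
     finite D \<and>
     (\<forall>(u, Z)\<in>D. monom u \<in> I \<and> stanley_space u Z \<subseteq> I) \<and>
     (\<forall>p\<in>I. \<exists>!f. f \<in> (\<Pi>\<^sub>E (u, Z)\<in>D. stanley_space u Z) \<and> p = (\<Sum>d\<in>D. f d))"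

definition sdepth_decomposition :: "('n expo \<times> 'n set) set \<Rightarrow> nat" where
  "sdepth_decomposition D = Min ((\<lambda>(u, Z). card Z) ` D)"

text \<open>
  The values are bounded by \<open>CARD('n)\<close>. \<open>Min\<close> is taken over the empty set only for \<open>I = {0}\<close>,
  where \<open>sdepth I\<close> has no meaning.
\<close>

definition sdepth :: "('n::finite, 'k::field) mpoly set \<Rightarrow> nat" where
  "sdepth I = Max {sdepth_decomposition D | D. stanley_decomposition I D}"

end

theory Submission
  imports Defs
begin

text \<open>
  Write \<open>v\<^sub>i\<close> also for the set of variables dividing the \<open>i\<close>-th generator. A monomial lies in
  \<open>I\<close> iff its support \<open>A\<close> contains one of the \<open>v\<^sub>i\<close>, so only supports matter. An interval
  \<open>[F, G]\<close> of supports corresponds to the Stanley space \<open>x\<^sup>F K[G]\<close>. Hence it suffices to partition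
  the family of all \<open>A\<close> containing some \<open>v\<^sub>i\<close> into intervals with \<open>card G \<ge> n - 2\<close>.

  Requiring that \<open>A\<close> contain a given set yields an interval with top \<open>UNIV\<close>. Forbidding \<open>A\<close> to
  contain a given set \<open>v\<close> costs at most one element of each top: sort the sets by the first element
  of \<open>v\<close> that they miss (\<open>interval_partitionable_not_containing\<close>). Thus one may use regions that
  prescribe arbitrarily many inclusions \<open>v\<^sub>i \<subseteq> A\<close> but forbid at most two. Five such regions suffice
  (\<open>interval_partitionable_four_filters\<close>):
  those \<open>A\<close> that contain \<open>v\<^sub>1\<close>, and, among those that do not, the ones that contain
  \<open>v\<^sub>2\<close> but not \<open>v\<^sub>4\<close>, or \<open>v\<^sub>3\<close> but not \<open>v\<^sub>2\<close>, or \<open>v\<^sub>4\<close> but not \<open>v\<^sub>3\<close>, or all three.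
  The cyclic pattern is the one behind the decomposition of the maximal ideal \<open>(x, y, z)\<close> into
  \<open>xK[x, y]\<close>, \<open>yK[y, z]\<close>, \<open>zK[z, x]\<close> and \<open>xyzK[x, y, z]\<close>. It needs no assumption of coprimality
  or minimality, since only the truth values of \<open>v\<^sub>i \<subseteq> A\<close> enter.

  On the algebraic side, every space that occurs is the span of a set of monomials, that is, the set
  of polynomials with support in it (\<open>polys_on\<close>). A partition of the monomials of \<open>I\<close> therefore gives
  a direct sum (\<open>stanley_decompositionI\<close>).
\<close>

section \<open>Partitions of set families into intervals\<close>

text \<open>
  The tops of the intervals miss at most \<open>k\<close> points. The inductive form lets refinements of
  a partition be built interval by interval; the partition itself is recovered in
  \<open>interval_partitionable_unique_intervals\<close>.
\<close>

inductive interval_partitionable :: "nat \<Rightarrow> 'a::finite set set \<Rightarrow> bool" for k where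
  empty: "interval_partitionable k {}"
| interval: "F \<subseteq> G \<Longrightarrow> CARD('a) \<le> card G + k \<Longrightarrow> interval_partitionable k {F..G}"
| union: "interval_partitionable k \<U> \<Longrightarrow> interval_partitionable k \<V> \<Longrightarrow> \<U> \<inter> \<V> = {} \<Longrightarrow>
    interval_partitionable k (\<U> \<union> \<V>)"

lemma interval_partitionable_mono:
  assumes "interval_partitionable k \<U>" "k \<le> l"
  shows "interval_partitionable l \<U>"
  using assms
proof induction
  case (interval F G)
  then show ?case by (intro interval_partitionable.interval) auto
next
  case (union \<U> \<V>)
  then show ?case by (intro interval_partitionable.union) auto
qed (rule interval_partitionable.empty)

text \<open>
  Sets that miss a chosen \<open>y \<in> v - F\<close> form the interval \<open>[F, G - {y}]\<close>; for the others \<open>y\<close> can be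
  added to \<open>F\<close>. The top shrinks only in the interval that is split off, so the loss is one point
  however large \<open>v\<close> is.
\<close>

lemma interval_partitionable_interval_not_containing:
  fixes F G v :: "'a::finite set"
  assumes "F \<subseteq> G" "CARD('a) \<le> card G + k"
  shows "interval_partitionable (Suc k) {A \<in> {F..G}. \<not> v \<subseteq> A}"
proof -
  \<comment> \<open>The bottom \<open>F\<close> grows towards \<open>v\<close>, so the induction is on \<open>v - F\<close>, with \<open>G\<close> unchanged.\<close>
  have "finite (v - F)" by simp
  then show ?thesis using assms
  proof (induction "v - F" arbitrary: F rule: finite_psubset_induct)
    case psubset
    show ?case
    proof (cases "v \<subseteq> F")
      case True
      then have none: "{A \<in> {F..G}. \<not> v \<subseteq> A} = {}" by auto
      show ?thesis unfolding none by (rule interval_partitionable.empty)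
    next
      case False
      then obtain y where y: "y \<in> v" "y \<notin> F" by auto
      show ?thesis
      proof (cases "y \<in> G")
        case True
        have "interval_partitionable (Suc k) {F..G - {y}}"
          using psubset.prems y by (intro interval_partitionable.interval) (auto simp: card_Diff_singleton_if)
        moreover have "interval_partitionable (Suc k) {A \<in> {insert y F..G}. \<not> v \<subseteq> A}"
          using y True psubset.prems by (intro psubset.hyps) auto
        moreover have "{A \<in> {F..G}. \<not> v \<subseteq> A} = {F..G - {y}} \<union> {A \<in> {insert y F..G}. \<not> v \<subseteq> A}"
          using y by (simp add: set_eq_iff) blast
        moreover have "{F..G - {y}} \<inter> {A \<in> {insert y F..G}. \<not> v \<subseteq> A} = {}"
          by (simp add: set_eq_iff) blast
        ultimately show ?thesis by (simp only: interval_partitionable.union)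
      next
        case False
        then have "{A \<in> {F..G}. \<not> v \<subseteq> A} = {F..G}"
          using y by (simp add: set_eq_iff) blast
        then show ?thesis
          using psubset.prems by (auto intro: interval_partitionable.interval)
      qed
    qed
  qed
qed

lemma interval_partitionable_not_containing:
  assumes "interval_partitionable k \<U>"
  shows "interval_partitionable (Suc k) {A \<in> \<U>. \<not> v \<subseteq> A}"
  using assms
proof induction
  case empty
  show ?case by (simp add: interval_partitionable.empty)
next
  case (interval F G)
  then show ?case by (rule interval_partitionable_interval_not_containing)
next
  case (union \<U> \<V>)
  have split: "{A \<in> \<U> \<union> \<V>. \<not> v \<subseteq> A} = {A \<in> \<U>. \<not> v \<subseteq> A} \<union> {A \<in> \<V>. \<not> v \<subseteq> A}" by auto
  show ?case
    unfolding split using union by (intro interval_partitionable.union) auto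
qed

lemma interval_partitionable_supersets: "interval_partitionable 0 {A. v \<subseteq> A}"
  using interval_partitionable.interval[of v UNIV 0] by (simp add: atLeastAtMost_def atLeast_def)

text \<open>
  In a set that contains some but not all of \<open>v2\<close>, \<open>v3\<close>, \<open>v4\<close>, exactly one member of the cyclic
  sequence \<open>v2\<close>, \<open>v3\<close>, \<open>v4\<close> is contained while its cyclic predecessor is not. This makes the last
  three regions below disjoint and, together with the first two, exhaustive.
\<close>

lemma interval_partitionable_four_filters:
  fixes v1 v2 v3 v4 :: "'a::finite set"
  shows "interval_partitionable 2 {A. v1 \<subseteq> A \<or> v2 \<subseteq> A \<or> v3 \<subseteq> A \<or> v4 \<subseteq> A}"
proof -
  have two: "interval_partitionable 2 {A. v \<subseteq> A \<and> \<not> w \<subseteq> A \<and> \<not> v1 \<subseteq> A}" for v w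
    using interval_partitionable_not_containing[of 1 "{A. v \<subseteq> A \<and> \<not> w \<subseteq> A}" v1]
      interval_partitionable_not_containing[OF interval_partitionable_supersets[of v], of w]
    by (simp add: numeral_2_eq_2)
  \<comment> \<open>One exclusion is enough here; \<open>two\<close> is applied with the same exclusion twice.\<close>
  have all: "interval_partitionable 2 {A. v2 \<union> v3 \<union> v4 \<subseteq> A \<and> \<not> v1 \<subseteq> A}"
    using two[of "v2 \<union> v3 \<union> v4" v1] by simp
  have first: "interval_partitionable 2 {A. v1 \<subseteq> A}"
    by (rule interval_partitionable_mono[OF interval_partitionable_supersets]) simp
  have "{A. v1 \<subseteq> A \<or> v2 \<subseteq> A \<or> v3 \<subseteq> A \<or> v4 \<subseteq> A} =
      {A. v1 \<subseteq> A} \<union> ({A. v2 \<union> v3 \<union> v4 \<subseteq> A \<and> \<not> v1 \<subseteq> A} \<union>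
      ({A. v2 \<subseteq> A \<and> \<not> v4 \<subseteq> A \<and> \<not> v1 \<subseteq> A} \<union> ({A. v3 \<subseteq> A \<and> \<not> v2 \<subseteq> A \<and> \<not> v1 \<subseteq> A} \<union>
       {A. v4 \<subseteq> A \<and> \<not> v3 \<subseteq> A \<and> \<not> v1 \<subseteq> A})))"
    by auto
  also have "interval_partitionable 2 \<dots>"
    by (intro interval_partitionable.union first all two) auto
  finally show ?thesis .
qed

lemma interval_partitionable_unique_intervals:
  fixes \<U> :: "'a::finite set set"
  assumes "interval_partitionable k \<U>"
  shows "\<exists>D. (\<forall>d \<in> D. fst d \<subseteq> snd d \<and> CARD('a) \<le> card (snd d) + k \<and> {fst d..snd d} \<subseteq> \<U>) \<and>
    (\<forall>A \<in> \<U>. \<exists>!d. d \<in> D \<and> A \<in> {fst d..snd d})"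
  using assms
proof induction
  case empty
  show ?case by (intro exI[of _ "{}"]) auto
next
  case (interval F G)
  then show ?case by (intro exI[of _ "{(F, G)}"]) auto
next
  case (union \<U> \<V>)
  from union.IH(1) obtain D where
    D: "\<forall>d \<in> D. fst d \<subseteq> snd d \<and> CARD('a) \<le> card (snd d) + k \<and> {fst d..snd d} \<subseteq> \<U>"
      "\<forall>A \<in> \<U>. \<exists>!d. d \<in> D \<and> A \<in> {fst d..snd d}" by (elim exE conjE)
  from union.IH(2) obtain E where
    E: "\<forall>d \<in> E. fst d \<subseteq> snd d \<and> CARD('a) \<le> card (snd d) + k \<and> {fst d..snd d} \<subseteq> \<V>"
      "\<forall>A \<in> \<V>. \<exists>!d. d \<in> E \<and> A \<in> {fst d..snd d}" by (elim exE conjE)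
  have unique: "\<exists>!d. d \<in> D \<union> E \<and> A \<in> {fst d..snd d}" if "A \<in> \<U> \<union> \<V>" for A
  proof (cases "A \<in> \<U>")
    case True
    then have "d \<notin> E \<or> A \<notin> {fst d..snd d}" for d
      using E(1) union.hyps(3) by blast
    then have "(d \<in> D \<union> E \<and> A \<in> {fst d..snd d}) = (d \<in> D \<and> A \<in> {fst d..snd d})" for d
      by blast
    then show ?thesis using bspec[OF D(2) True] by (simp only:)
  next
    case False
    then have "d \<notin> D \<or> A \<notin> {fst d..snd d}" for d
      using D(1) by blast
    then have "(d \<in> D \<union> E \<and> A \<in> {fst d..snd d}) = (d \<in> E \<and> A \<in> {fst d..snd d})" for d
      by blast
    moreover have "A \<in> \<V>" using that False by blast
    ultimately show ?thesis using bspec[OF E(2)] by (simp only:)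
  qed
  have valid: "\<forall>d \<in> D \<union> E. fst d \<subseteq> snd d \<and> CARD('a) \<le> card (snd d) + k \<and> {fst d..snd d} \<subseteq> \<U> \<union> \<V>"
    using D(1) E(1) by blast
  show ?case
    by (rule exI[of _ "D \<union> E"], rule conjI[OF valid], rule ballI, erule unique)
qed

section \<open>Spaces spanned by monomials\<close>

definition polys_on :: "'n expo set \<Rightarrow> ('n, 'k::field) mpoly set" where
  "polys_on M = {p. Poly_Mapping.keys p \<subseteq> M}"

text \<open>The exponents of the monomials in \<open>x\<^sup>u K[Z]\<close>; for \<open>Z = UNIV\<close>, of all multiples of \<open>x\<^sup>u\<close>.\<close>

definition multiples :: "'n expo \<Rightarrow> 'n set \<Rightarrow> 'n expo set" where
  "multiples u Z = {u + w | w. Poly_Mapping.keys w \<subseteq> Z}"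

lemma monom_mult: "monom a * monom b = monom (a + b)"
  by (simp add: monom_def mult_single)

lemma keys_monom [simp]: "Poly_Mapping.keys (monom a :: ('n, 'k::field) mpoly) = {a}"
  by (simp add: monom_def)

lemma mpoly_eq_sum_single:
  fixes p :: "('n, 'k::field) mpoly"
  shows "p = (\<Sum>w\<in>Poly_Mapping.keys p. Poly_Mapping.single w (Poly_Mapping.lookup p w))"
  by (rule poly_mapping_eqI) (simp add: lookup_sum lookup_single when_def in_keys_iff)

lemma scale_monom: "scale c (monom a) = Poly_Mapping.single a c"
  by (simp add: scale_def monom_def mult_single)

lemma keys_scale: "Poly_Mapping.keys (scale c p) \<subseteq> Poly_Mapping.keys p"
  using keys_mult[of "Poly_Mapping.single 0 c" p] by (auto simp: scale_def split: if_splits)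

lemma span_monom:
  "module.span scale (monom ` M) = (polys_on M :: ('n, 'k::field) mpoly set)"
proof -
  interpret vector_space "scale :: 'k \<Rightarrow> ('n, 'k) mpoly \<Rightarrow> _" by (rule vector_space_scale)
  show ?thesis
  proof
    show "span (monom ` M) \<subseteq> (polys_on M :: ('n, 'k) mpoly set)"
    proof (rule span_minimal)
      show "subspace (polys_on M :: ('n, 'k) mpoly set)"
        using keys_add keys_scale unfolding subspace_def polys_on_def by fastforce
    qed (auto simp: polys_on_def)
  next
    show "(polys_on M :: ('n, 'k) mpoly set) \<subseteq> span (monom ` M)"
    proof
      fix p :: "('n, 'k) mpoly" assume "p \<in> polys_on M"
      then have "(\<Sum>w\<in>Poly_Mapping.keys p. scale (Poly_Mapping.lookup p w) (monom w)) \<in> span (monom ` M)"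
        by (intro span_sum span_scale span_base) (auto simp: polys_on_def)
      then show "p \<in> span (monom ` M)"
        using mpoly_eq_sum_single[of p] by (simp add: scale_monom)
    qed
  qed
qed

lemma stanley_space_eq_polys_on:
  "stanley_space u Z = (polys_on (multiples u Z) :: ('n, 'k::field) mpoly set)"
proof -
  have gens: "{monom u * monom w | w. Poly_Mapping.keys w \<subseteq> Z} =
      (monom ` multiples u Z :: ('n, 'k) mpoly set)"
    by (auto simp: multiples_def monom_mult)
  show ?thesis unfolding stanley_space_def gens by (rule span_monom)
qed

lemma self_in_multiples: "u \<in> multiples u Z"
  unfolding multiples_def by (auto intro: exI[of _ 0])

text \<open>
  Exponents of multiples of the generators are closed under adding any exponent, so the polynomials
  supported on them form an ideal; conversely each such term is a polynomial times a generator.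
\<close>

lemma ideal_generated_monom:
  "ideal_generated (monom ` B) = (polys_on (\<Union>b\<in>B. multiples b UNIV) :: ('n, 'k::field) mpoly set)"
proof -
  interpret module "(*) :: ('n, 'k) mpoly \<Rightarrow> _" by (rule module_mult)
  define M where "M = (\<Union>b\<in>B. multiples b UNIV)"
  have add_closed: "a + w \<in> M" if "w \<in> M" for a w
    using that by (auto simp: M_def multiples_def) (metis add.left_commute)
  have mult_closed: "c * p \<in> polys_on M" if "p \<in> polys_on M" for c p :: "('n, 'k) mpoly"
    unfolding polys_on_def
  proof (intro CollectI subsetI)
    fix w assume "w \<in> Poly_Mapping.keys (c * p)"
    then obtain a b where "b \<in> Poly_Mapping.keys p" "w = a + b" using keys_mult[of c p] by blast
    moreover from this(1) have "b \<in> M" using that by (auto simp: polys_on_def)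
    ultimately show "w \<in> M" using add_closed by simp
  qed
  have "span (monom ` B) = (polys_on M :: ('n, 'k) mpoly set)"
  proof
    show "span (monom ` B) \<subseteq> (polys_on M :: ('n, 'k) mpoly set)"
    proof (rule span_minimal)
      have "p + q \<in> polys_on M" if "p \<in> polys_on M" "q \<in> polys_on M" for p q :: "('n, 'k) mpoly"
        using keys_add[of p q] that unfolding polys_on_def by blast
      then show "subspace (polys_on M :: ('n, 'k) mpoly set)"
        using mult_closed by (simp add: subspace_def polys_on_def)
      show "monom ` B \<subseteq> (polys_on M :: ('n, 'k) mpoly set)"
        using self_in_multiples by (fastforce simp: polys_on_def M_def)
    qed
  next
    show "(polys_on M :: ('n, 'k) mpoly set) \<subseteq> span (monom ` B)"
    proof
      fix p :: "('n, 'k) mpoly" assume p: "p \<in> polys_on M"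
      have "Poly_Mapping.single w c \<in> span (monom ` B)" if "w \<in> M" for w and c :: 'k
      proof -
        obtain b a where "b \<in> B" "w = b + a" using \<open>w \<in> M\<close> by (auto simp: M_def multiples_def)
        moreover have "Poly_Mapping.single a c * monom b \<in> span (monom ` B)"
          using \<open>b \<in> B\<close> by (intro span_scale span_base) auto
        ultimately show ?thesis by (simp add: monom_def mult_single add.commute)
      qed
      then have "(\<Sum>w\<in>Poly_Mapping.keys p. Poly_Mapping.single w (Poly_Mapping.lookup p w)) \<in> span (monom ` B)"
        using p by (intro span_sum) (auto simp: polys_on_def)
      then show "p \<in> span (monom ` B)" using mpoly_eq_sum_single[of p] by simp
    qed
  qed
  then show ?thesis by (simp add: ideal_generated_def M_def)
qed

section \<open>Stanley decompositions from partitions of the monomials\<close>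

lemma lookup_sum_of_disjoint_supports:
  fixes f :: "'d \<Rightarrow> ('n, 'k::field) mpoly"
  assumes "finite D" "d \<in> D" "w \<in> C d"
    and "\<And>e. e \<in> D \<Longrightarrow> f e \<in> polys_on (C e)"
    and "\<And>e. e \<in> D \<Longrightarrow> w \<in> C e \<Longrightarrow> e = d"
  shows "Poly_Mapping.lookup (\<Sum>e\<in>D. f e) w = Poly_Mapping.lookup (f d) w"
proof -
  have "Poly_Mapping.lookup (f e) w = 0" if "e \<in> D - {d}" for e
    using that assms(4)[of e] assms(5)[of e] unfolding polys_on_def by (auto simp: in_keys_iff)
  then show ?thesis
    by (simp add: lookup_sum sum.remove[OF assms(1,2), of "\<lambda>e. Poly_Mapping.lookup (f e) w"])
qed

text \<open>
  If the exponent sets of the spaces partition \<open>M\<close>, the component of \<open>p\<close> in a space must consist of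
  the terms of \<open>p\<close> with exponents in that space, because no other component contributes there.
\<close>

lemma stanley_decompositionI:
  fixes D :: "('n expo \<times> 'n set) set"
  assumes fin: "finite D"
    and sub: "\<And>u Z. (u, Z) \<in> D \<Longrightarrow> multiples u Z \<subseteq> M"
    and uniq: "\<And>w. w \<in> M \<Longrightarrow> \<exists>!d. d \<in> D \<and> w \<in> multiples (fst d) (snd d)"
  shows "stanley_decomposition (polys_on M :: ('n, 'k::field) mpoly set) D"
proof -
  define C where "C d = multiples (fst d) (snd d)" for d :: "'n expo \<times> 'n set"
  have space: "(case d of (u, Z) \<Rightarrow> stanley_space u Z) = (polys_on (C d) :: ('n, 'k) mpoly set)" for d
    by (simp add: C_def case_prod_unfold stanley_space_eq_polys_on)
  have unique_sum: "\<exists>!f. f \<in> (\<Pi>\<^sub>E d\<in>D. polys_on (C d)) \<and> p = (\<Sum>d\<in>D. f d)"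
    if p: "p \<in> polys_on M" for p :: "('n, 'k) mpoly"
  proof -
    define part where
      "part d = Poly_Mapping.mapp (\<lambda>w c. if w \<in> C d then c else 0) p" for d
    have lookup_part: "Poly_Mapping.lookup (part d) w = (if w \<in> C d then Poly_Mapping.lookup p w else 0)" for d w
      by (auto simp: part_def lookup_mapp when_def in_keys_iff)
    have part_on: "part d \<in> polys_on (C d)" for d
      by (auto simp: polys_on_def in_keys_iff lookup_part split: if_splits)
    have lookup_sum: "Poly_Mapping.lookup (\<Sum>d\<in>D. f d) w = Poly_Mapping.lookup (f d) w"
      if "\<And>e. e \<in> D \<Longrightarrow> f e \<in> polys_on (C e)" "d \<in> D" "w \<in> C d"
      for f :: "_ \<Rightarrow> ('n, 'k) mpoly" and d w
    proof (rule lookup_sum_of_disjoint_supports[where C = C, OF fin])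
      have "w \<in> M" using sub that by (cases d) (auto simp: C_def)
      then show "e = d" if "e \<in> D" "w \<in> C e" for e
        using uniq[of w] that \<open>d \<in> D\<close> \<open>w \<in> C d\<close> by (auto simp: C_def)
    qed (use that in auto)
    have sum_part: "p = (\<Sum>d\<in>D. part d)"
    proof (rule poly_mapping_eqI)
      fix w
      show "Poly_Mapping.lookup p w = Poly_Mapping.lookup (\<Sum>d\<in>D. part d) w"
      proof (cases "w \<in> M")
        case True
        then obtain d where "d \<in> D" "w \<in> C d" using uniq[of w] by (auto simp: C_def)
        then show ?thesis using lookup_sum[of part d w] part_on by (simp add: lookup_part)
      next
        case False
        then have "Poly_Mapping.lookup p w = 0" using p by (auto simp: polys_on_def in_keys_iff)
        then have "Poly_Mapping.lookup (part d) w = 0" for d by (simp add: lookup_part)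
        with \<open>Poly_Mapping.lookup p w = 0\<close> show ?thesis by (simp add: Poly_Mapping.lookup_sum)
      qed
    qed
    show ?thesis
    proof (rule ex1I[of _ "restrict part D"])
      \<comment> \<open>Elements of a dependent product are undefined off \<open>D\<close>, hence the restriction.\<close>
      show "restrict part D \<in> (\<Pi>\<^sub>E d\<in>D. polys_on (C d)) \<and> p = (\<Sum>d\<in>D. restrict part D d)"
        using part_on sum_part by auto
    next
      fix f assume f: "f \<in> (\<Pi>\<^sub>E d\<in>D. polys_on (C d)) \<and> p = (\<Sum>d\<in>D. f d)"
      have "f d = part d" if "d \<in> D" for d
      proof (rule poly_mapping_eqI)
        fix w
        have "f d \<in> polys_on (C d)" using f that by auto
        then have "w \<notin> C d \<Longrightarrow> Poly_Mapping.lookup (f d) w = 0"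
          by (auto simp: polys_on_def in_keys_iff)
        moreover have "w \<in> C d \<Longrightarrow> Poly_Mapping.lookup p w = Poly_Mapping.lookup (f d) w"
          using lookup_sum[of f d w] f that by (auto simp: PiE_iff)
        ultimately show "Poly_Mapping.lookup (f d) w = Poly_Mapping.lookup (part d) w"
          by (simp add: lookup_part)
      qed
      then show "f = restrict part D" using f by (auto simp: PiE_iff extensional_def)
    qed
  qed
  have monom_in: "monom u \<in> (polys_on M :: ('n, 'k) mpoly set)" if "(u, Z) \<in> D" for u Z
    using sub[OF that] self_in_multiples by (auto simp: polys_on_def)
  have space_sub: "(stanley_space u Z :: ('n, 'k) mpoly set) \<subseteq> polys_on M" if "(u, Z) \<in> D" for u Z
    using sub[OF that] by (auto simp: stanley_space_eq_polys_on polys_on_def)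
  have spaces_valid: "\<forall>(u, Z) \<in> D. monom u \<in> (polys_on M :: ('n, 'k) mpoly set) \<and>
      (stanley_space u Z :: ('n, 'k) mpoly set) \<subseteq> polys_on M"
    using monom_in space_sub by blast
  show ?thesis
    unfolding stanley_decomposition_def space
    by (rule conjI[OF fin conjI[OF spaces_valid]], rule ballI, erule unique_sum)
qed

section \<open>Squarefree exponents\<close>

definition squarefree_expo :: "'n::finite set \<Rightarrow> 'n expo" where
  "squarefree_expo F = Abs_poly_mapping (\<lambda>i. if i \<in> F then 1 else 0)"

lemma lookup_squarefree_expo [simp]:
  "Poly_Mapping.lookup (squarefree_expo F) i = (if i \<in> F then 1 else 0)"
  by (simp add: squarefree_expo_def)

lemma keys_squarefree_expo [simp]: "Poly_Mapping.keys (squarefree_expo F) = F"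
  by (auto simp: in_keys_iff split: if_splits)

lemma squarefree_monomial_iff:
  "squarefree_monomial (v :: ('n::finite, 'k::field) mpoly) \<longleftrightarrow> (\<exists>F. v = monom (squarefree_expo F))"
proof
  assume "squarefree_monomial v"
  then obtain a where a: "v = monom a" "\<And>i. Poly_Mapping.lookup a i \<le> 1"
    by (auto simp: squarefree_monomial_def)
  have "a = squarefree_expo (Poly_Mapping.keys a)"
  proof (rule poly_mapping_eqI)
    fix i
    show "Poly_Mapping.lookup a i = Poly_Mapping.lookup (squarefree_expo (Poly_Mapping.keys a)) i"
      using a(2)[of i] by (auto simp: in_keys_iff)
  qed
  then show "\<exists>F. v = monom (squarefree_expo F)" using a(1) by metis
qed (auto simp: squarefree_monomial_def)

text \<open>
  The bridge between intervals and Stanley spaces: the bottom is squarefree, so divisibility by it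
  is decided by the support alone.
\<close>

lemma multiples_squarefree_expo:
  assumes "F \<subseteq> Z"
  shows "multiples (squarefree_expo F) Z = {w. Poly_Mapping.keys w \<in> {F..Z}}"
proof (intro set_eqI iffI)
  fix w assume "w \<in> multiples (squarefree_expo F) Z"
  then obtain c where "w = squarefree_expo F + c" "Poly_Mapping.keys c \<subseteq> Z"
    by (auto simp: multiples_def)
  then show "w \<in> {w. Poly_Mapping.keys w \<in> {F..Z}}"
    using assms by (auto simp: in_keys_iff lookup_add subset_eq split: if_splits)
next
  fix w :: "'a expo" assume w: "w \<in> {w. Poly_Mapping.keys w \<in> {F..Z}}"
  have "w = squarefree_expo F + (w - squarefree_expo F)"
  proof (rule poly_mapping_eqI)
    fix i
    have "i \<in> F \<Longrightarrow> Poly_Mapping.lookup w i \<noteq> 0" using w by (auto simp: in_keys_iff subset_eq)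
    then show "Poly_Mapping.lookup w i = Poly_Mapping.lookup (squarefree_expo F + (w - squarefree_expo F)) i"
      by (auto simp: lookup_add lookup_minus)
  qed
  moreover have "Poly_Mapping.keys (w - squarefree_expo F) \<subseteq> Z"
    using w by (auto simp: in_keys_iff lookup_minus subset_eq)
  ultimately show "w \<in> multiples (squarefree_expo F) Z" by (auto simp: multiples_def)
qed

lemma stanley_decomposition_of_interval_partition:
  fixes \<U> :: "'n::finite set set"
  assumes "interval_partitionable k \<U>"
  obtains D where
    "stanley_decomposition (polys_on {w. Poly_Mapping.keys w \<in> \<U>} :: ('n, 'k::field) mpoly set) D"
    "\<And>u Z. (u, Z) \<in> D \<Longrightarrow> CARD('n) \<le> card Z + k"
proof -
  obtain E where
    E: "\<forall>e \<in> E. fst e \<subseteq> snd e \<and> CARD('n) \<le> card (snd e) + k \<and> {fst e..snd e} \<subseteq> \<U>"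
      "\<forall>A \<in> \<U>. \<exists>!e. e \<in> E \<and> A \<in> {fst e..snd e}"
    using interval_partitionable_unique_intervals[OF assms] by (elim exE conjE)
  define space where "space e = (squarefree_expo (fst e), snd e)" for e :: "'n set \<times> 'n set"
  have mult: "multiples (fst (space e)) (snd (space e)) = {w. Poly_Mapping.keys w \<in> {fst e..snd e}}"
    if "e \<in> E" for e
    using bspec[OF E(1) that] by (simp add: space_def multiples_squarefree_expo)
  show ?thesis
  proof (rule that[of "space ` E"])
    show "stanley_decomposition (polys_on {w. Poly_Mapping.keys w \<in> \<U>} :: ('n, 'k) mpoly set) (space ` E)"
    proof (rule stanley_decompositionI)
      show "finite (space ` E)" by simp
    next
      fix u Z assume "(u, Z) \<in> space ` E"
      then obtain e where e: "e \<in> E" "space e = (u, Z)" by auto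
      then have "multiples u Z = {w. Poly_Mapping.keys w \<in> {fst e..snd e}}" using mult[OF e(1)] by simp
      also have "\<dots> \<subseteq> {w. Poly_Mapping.keys w \<in> \<U>}" using bspec[OF E(1) e(1)] by blast
      finally show "multiples u Z \<subseteq> {w. Poly_Mapping.keys w \<in> \<U>}" .
    next
      fix w :: "'n expo" assume "w \<in> {w. Poly_Mapping.keys w \<in> \<U>}"
      then have "Poly_Mapping.keys w \<in> \<U>" by simp
      from bspec[OF E(2) this] obtain e where
        e: "e \<in> E" "Poly_Mapping.keys w \<in> {fst e..snd e}"
          and e_unique: "\<And>e'. e' \<in> E \<Longrightarrow> Poly_Mapping.keys w \<in> {fst e'..snd e'} \<Longrightarrow> e' = e"
        by (elim ex1E) blast
      show "\<exists>!d. d \<in> space ` E \<and> w \<in> multiples (fst d) (snd d)"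
      proof (rule ex1I[of _ "space e"])
        show "space e \<in> space ` E \<and> w \<in> multiples (fst (space e)) (snd (space e))"
          using e mult by simp
      next
        fix d assume d: "d \<in> space ` E \<and> w \<in> multiples (fst d) (snd d)"
        then obtain e' where "e' \<in> E" "d = space e'" by blast
        then show "d = space e" using d e_unique[of e'] mult[of e'] by simp
      qed
    qed
  next
    show "CARD('n) \<le> card Z + k" if "(u, Z) \<in> space ` E" for u Z
      using that E(1) by (auto simp: space_def)
  qed
qed

section \<open>The lower bound on the Stanley depth\<close>

lemma stanley_decomposition_nonempty:
  assumes "stanley_decomposition I D" "p \<in> I" "p \<noteq> 0"
  shows "D \<noteq> {}"
  using assms by (auto simp: stanley_decomposition_def)

text \<open>
  A nonzero element of \<open>I\<close> makes every Stanley decomposition nonempty. Then all the minima are taken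
  over nonempty sets and bounded by the number of variables, so the maximum is over a finite set.
\<close>

lemma sdepth_geI:
  fixes I :: "('n::finite, 'k::field) mpoly set"
  assumes D: "stanley_decomposition I D"
    and p: "p \<in> I" "p \<noteq> 0"
    and card: "\<And>u Z. (u, Z) \<in> D \<Longrightarrow> m \<le> card Z"
  shows "m \<le> sdepth I"
proof -
  have le: "sdepth_decomposition E \<le> CARD('n)" if E: "stanley_decomposition I E" for E
  proof -
    obtain u Z where "(u, Z) \<in> E" using stanley_decomposition_nonempty[OF E p] by fast
    moreover have "finite E" using E by (simp add: stanley_decomposition_def)
    ultimately have "sdepth_decomposition E \<le> card Z"
      unfolding sdepth_decomposition_def by (intro Min_le) force+
    also have "\<dots> \<le> CARD('n)" by (simp add: card_mono)
    finally show ?thesis .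
  qed
  have "m \<le> sdepth_decomposition D"
    using D stanley_decomposition_nonempty[OF D p] card
    by (auto simp: sdepth_decomposition_def stanley_decomposition_def)
  also have "\<dots> \<le> sdepth I" unfolding sdepth_def
  proof (rule Max_ge)
    have "{sdepth_decomposition D |D. stanley_decomposition I D} \<subseteq> {..CARD('n)}" using le by auto
    then show "finite {sdepth_decomposition D |D. stanley_decomposition I D}"
      using finite_subset by blast
  qed (use D in auto)
  finally show ?thesis .
qed

theorem proposition4p2:
  fixes v1 v2 v3 v4 :: "('n::finite, 'k::field) mpoly"
    and I :: "('n, 'k) mpoly set"
  assumes "squarefree_monomial v1" "squarefree_monomial v2"
    and "squarefree_monomial v3" "squarefree_monomial v4"
    and "I = ideal_generated {v1, v2, v3, v4}"
  shows "int (sdepth I) \<ge> int CARD('n) - 2"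
proof -
  obtain F1 F2 F3 F4 where v: "v1 = monom (squarefree_expo F1)" "v2 = monom (squarefree_expo F2)"
      "v3 = monom (squarefree_expo F3)" "v4 = monom (squarefree_expo F4)"
    using assms(1-4) by (auto simp: squarefree_monomial_iff)
  let ?U = "{A. F1 \<subseteq> A \<or> F2 \<subseteq> A \<or> F3 \<subseteq> A \<or> F4 \<subseteq> A}"
  have "I = ideal_generated (monom ` squarefree_expo ` {F1, F2, F3, F4})"
    using assms(5) v by simp
  also have "\<dots> = polys_on (\<Union>b\<in>squarefree_expo ` {F1, F2, F3, F4}. multiples b UNIV)"
    by (rule ideal_generated_monom)
  also have "(\<Union>b\<in>squarefree_expo ` {F1, F2, F3, F4}. multiples b UNIV) = {w. Poly_Mapping.keys w \<in> ?U}"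
    by (auto simp: multiples_squarefree_expo)
  finally have I: "I = polys_on {w. Poly_Mapping.keys w \<in> ?U}" .
  obtain D where
    D: "stanley_decomposition (polys_on {w. Poly_Mapping.keys w \<in> ?U} :: ('n, 'k) mpoly set) D"
      "\<And>u Z. (u, Z) \<in> D \<Longrightarrow> CARD('n) \<le> card Z + 2"
    by (rule stanley_decomposition_of_interval_partition[where 'k = 'k,
          OF interval_partitionable_four_filters[of F1 F2 F3 F4]]) (rule that)
  have "v1 \<in> I" using I v by (simp add: polys_on_def)
  moreover have "v1 \<noteq> 0" using v(1) keys_monom keys_zero by (metis insert_not_empty)
  ultimately have "CARD('n) - 2 \<le> sdepth I"
    using D(2) by (intro sdepth_geI[OF D(1)[folded I]]) (auto simp: le_diff_conv)
  then show ?thesis by linarith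
qed

end
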